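(* If $\mathcal{M}$ is a multi-armed bandit (an MDP with $H=1$ and a single state) with gaps $\Delta(a)$ and effective gaps $\widetilde\Delta(a)$, then $$\mathcal{C}(\mathcal{M},\epsilon)=\sum_a\min\Big\{\frac1{\widetilde\Delta(a)^2},\frac1{\epsilon^2}\Big\},\qquad \mathcal{C}^\star(\mathcal{M})=\sum_{a:\Delta(a)>0}\frac1{\Delta(a)^2}.$$ Furthermore, if $\mathcal{M}$ is a contextual bandit (an MDP with $H=1$), with gaps $\Delta(s,a)$ and maximum reachability $W(s)$, then $$\mathcal{C}^\star(\mathcal{M})=\max_s\frac{1}{W(s)}\sum_{a:\Delta(s,a)>0}\frac{1}{\Delta(s,a)^2}.$$ (The quantity $\mathcal{C}^\star(\mathcal{M})$ is defined when $\mathcal{M}$ has unique optimal actions.)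
   Context: **MDPs.** $\mathcal{M}$ is a finite-horizon MDP with finite state and action sets, horizon $H$, initial distribution $P_0$, and rewards in $[0,1]$; for $H=1$, in each episode a state $s\sim P_0$ is drawn, an action is chosen, and a reward with mean $r(s,a)$ is received, so $\Delta(s,a)=\max_{a'}r(s,a')-r(s,a)$ and $W(s)=P_0(s)$ (the step index, and for a single state also the state, is dropped). Policies may be deterministic or stochastic. In general $\Delta_h(s,a)=V_h^\star(s)-Q_h^\star(s,a)$, with $V_h^\star,Q_h^\star$ the optimal value and action-value functions; action $a$ is optimal at $(s,h)$ if $\Delta_h(s,a)=0$; unique optimal actions means exactly one optimal action at each $(s,h)$. $\widetilde\Delta_h(s,a)$ equals $\Delta_h(s,a)$ if $\Delta_h(s,a)>0$; $\min_{a':\Delta_h(s,a')>0}\Delta_h(s,a')$ (with $\min\emptyset=+\infty$, relevant only if there is a single action) if $a$ is the unique optimal action at $(s,h)$; $0$ if $a$ is one of several optimal actions. $w_h^\pi(s,a)=\mathbb{P}_\pi[s_h=s,a_h=a]$, $W_h(s)=\sup_\pi\mathbb{P}_\pi[s_h=s]$. **Complexities.** For $\epsilon>0$, $$\mathcal{C}(\mathcal{M},\epsilon)=\sum_{h=1}^H\inf_\pi\max_{s,a}\min\Big\{\frac{1}{w_h^\pi(s,a)\widetilde\Delta_h(s,a)^2},\frac{W_h(s)^2}{w_h^\pi(s,a)\epsilon^2}\Big\}+\frac{H^2|\mathrm{OPT}(\epsilon)|}{\epsilon^2},$$ $\mathrm{OPT}(\epsilon)=\{(s,a,h):\epsilon\ge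 W_h(s)\widetilde\Delta_h(s,a)/3\}$; and, when $\mathcal{M}$ has unique optimal actions, $$\mathcal{C}^\star(\mathcal{M})=\sum_{h=1}^H\inf_\pi\max_{s,a:\,\Delta_h(s,a)>0}\frac{1}{w_h^\pi(s,a)\Delta_h(s,a)^2}.$$ Infima are over all policies; if $W_h(s)=0$ then $W_h(s)^2/(w_h^\pi(s,a)\epsilon^2)$ is taken to be $0$, and otherwise $1/0=+\infty$.
   Formalization: The first identity is false as printed, since C(M,ε) includes |OPT(ε)|/ε²; with S the printed sum, what is proved is C = S + |OPT(ε)|/ε², S ≤ C ≤ 10S, and C = S exactly when OPT(ε) is empty. Both C* identities are as printed. *)

theory Defs
  imports "HOL-Probability.Probability"
begin

text \<open>Steps are numbered from 1 to \<open>horizon M\<close>; the fields at other indices are irrelevant.\<close>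

record ('s, 'a) mdp =
  horizon :: nat
  init_dist :: "'s pmf"
  trans_kernel :: "nat \<Rightarrow> 's \<Rightarrow> 'a \<Rightarrow> 's pmf"
  reward_dist :: "nat \<Rightarrow> 's \<Rightarrow> 'a \<Rightarrow> real measure"

definition is_mdp :: "('s::finite, 'a::finite) mdp \<Rightarrow> bool" where
  "is_mdp M \<longleftrightarrow> 1 \<le> horizon M \<and>
     (\<forall>h\<in>{1..horizon M}. \<forall>s a.
        prob_space (reward_dist M h s a) \<and> sets (reward_dist M h s a) = sets borel \<and>
        (AE x in reward_dist M h s a. 0 \<le> x \<and> x \<le> 1))"

definition mean_reward :: "('s, 'a) mdp \<Rightarrow> nat \<Rightarrow> 's \<Rightarrow> 'a \<Rightarrow> real" where
  "mean_reward M h s a = (\<integral>x. x \<partial>reward_dist M h s a)"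

text \<open>Policies are stochastic Markov policies; the deterministic ones are those whose
  values are all of the form \<open>return_pmf a\<close>.\<close>

type_synonym ('s, 'a) policy = "nat \<Rightarrow> 's \<Rightarrow> 'a pmf"

text \<open>The law of \<open>s\<^bsub>h+k\<^esub>\<close> under \<open>\<pi>\<close> when \<open>s\<^bsub>h\<^esub>\<close> has law \<open>p\<close>.\<close>

primrec law_from ::
  "('s, 'a) mdp \<Rightarrow> ('s, 'a) policy \<Rightarrow> nat \<Rightarrow> 's pmf \<Rightarrow> nat \<Rightarrow> 's pmf" where
  "law_from M \<pi> h p 0 = p"
| "law_from M \<pi> h p (Suc k) =
     bind_pmf (law_from M \<pi> h p k) (\<lambda>s. bind_pmf (\<pi> (h + k) s) (trans_kernel M (h + k) s))"

definition state_law :: "('s, 'a) mdp \<Rightarrow> ('s, 'a) policy \<Rightarrow> nat \<Rightarrow> 's pmf" where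
  "state_law M \<pi> h = law_from M \<pi> 1 (init_dist M) (h - 1)"

definition state_action_law :: "('s, 'a) mdp \<Rightarrow> ('s, 'a) policy \<Rightarrow> nat \<Rightarrow> ('s \<times> 'a) pmf" where
  "state_action_law M \<pi> h = bind_pmf (state_law M \<pi> h) (\<lambda>s. map_pmf (Pair s) (\<pi> h s))"

definition visitation :: "('s, 'a) mdp \<Rightarrow> ('s, 'a) policy \<Rightarrow> nat \<Rightarrow> 's \<Rightarrow> 'a \<Rightarrow> real" where
  "visitation M \<pi> h s a = pmf (state_action_law M \<pi> h) (s, a)"

definition max_reach :: "('s, 'a) mdp \<Rightarrow> nat \<Rightarrow> 's \<Rightarrow> real" where
  "max_reach M h s = (SUP \<pi>. pmf (state_law M \<pi> h) s)"

definition value_fun :: "('s, 'a) mdp \<Rightarrow> ('s, 'a) policy \<Rightarrow> nat \<Rightarrow> 's \<Rightarrow> real" where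
  "value_fun M \<pi> h s =
     (\<Sum>h'=h..horizon M.
        measure_pmf.expectation (law_from M \<pi> h (return_pmf s) (h' - h))
          (\<lambda>s'. measure_pmf.expectation (\<pi> h' s') (mean_reward M h' s')))"

definition action_value ::
  "('s, 'a) mdp \<Rightarrow> ('s, 'a) policy \<Rightarrow> nat \<Rightarrow> 's \<Rightarrow> 'a \<Rightarrow> real" where
  "action_value M \<pi> h s a =
     mean_reward M h s a
     + measure_pmf.expectation (trans_kernel M h s a) (value_fun M \<pi> (h + 1))"

definition opt_value :: "('s, 'a) mdp \<Rightarrow> nat \<Rightarrow> 's \<Rightarrow> real" where
  "opt_value M h s = (SUP \<pi>. value_fun M \<pi> h s)"

definition opt_action_value :: "('s, 'a) mdp \<Rightarrow> nat \<Rightarrow> 's \<Rightarrow> 'a \<Rightarrow> real" where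
  "opt_action_value M h s a = (SUP \<pi>. action_value M \<pi> h s a)"

definition gap :: "('s, 'a) mdp \<Rightarrow> nat \<Rightarrow> 's \<Rightarrow> 'a \<Rightarrow> real" where
  "gap M h s a = opt_value M h s - opt_action_value M h s a"

definition optimal_action :: "('s, 'a) mdp \<Rightarrow> nat \<Rightarrow> 's \<Rightarrow> 'a \<Rightarrow> bool" where
  "optimal_action M h s a \<longleftrightarrow> gap M h s a = 0"

definition unique_optimal_actions :: "('s, 'a) mdp \<Rightarrow> bool" where
  "unique_optimal_actions M \<longleftrightarrow> (\<forall>h\<in>{1..horizon M}. \<forall>s. \<exists>!a. optimal_action M h s a)"

text \<open>The infimum below runs over a finite set, so it is a minimum, or \<open>\<infinity>\<close> if the set is empty.\<close>

definition eff_gap :: "('s, 'a) mdp \<Rightarrow> nat \<Rightarrow> 's \<Rightarrow> 'a \<Rightarrow> ennreal" where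
  "eff_gap M h s a =
     (if gap M h s a > 0 then ennreal (gap M h s a)
      else if \<exists>!a'. optimal_action M h s a'
      then (INF a'\<in>{a'. gap M h s a' > 0}. ennreal (gap M h s a'))
      else 0)"

definition OPT :: "('s, 'a) mdp \<Rightarrow> real \<Rightarrow> ('s \<times> 'a \<times> nat) set" where
  "OPT M \<epsilon> = {(s, a, h). h \<in> {1..horizon M} \<and>
     ennreal \<epsilon> \<ge> ennreal (max_reach M h s) * eff_gap M h s a / 3}"

text \<open>Both complexities take values in \<open>[0, \<infinity>]\<close>, where \<open>1 / 0 = \<infinity>\<close>, \<open>\<infinity> * 0 = 0\<close> and
  \<open>0 / x = 0\<close> for every \<open>x\<close>; in particular the term with \<open>W\<^sub>h(s)\<^sup>2\<close> in the numerator vanishes when \<open>W\<^sub>h(s) = 0\<close>.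
  The suprema over state-action pairs run over finite sets, so they are maxima
  (with value 0 for the empty set).\<close>

definition complexity :: "('s, 'a) mdp \<Rightarrow> real \<Rightarrow> ennreal" where
  "complexity M \<epsilon> =
     (\<Sum>h=1..horizon M. INF \<pi>. SUP (s, a)\<in>UNIV.
        min (1 / (ennreal (visitation M \<pi> h s a) * (eff_gap M h s a)\<^sup>2))
            ((ennreal (max_reach M h s))\<^sup>2 / (ennreal (visitation M \<pi> h s a) * (ennreal \<epsilon>)\<^sup>2)))
     + of_nat ((horizon M)\<^sup>2 * card (OPT M \<epsilon>)) / (ennreal \<epsilon>)\<^sup>2"

text \<open>Meant for \<open>M\<close> with unique optimal actions.\<close>

definition complexity_star :: "('s, 'a) mdp \<Rightarrow> ennreal" where
  "complexity_star M =
     (\<Sum>h=1..horizon M. INF \<pi>. SUP (s, a)\<in>{(s, a). gap M h s a > 0}.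
        1 / (ennreal (visitation M \<pi> h s a) * (ennreal (gap M h s a))\<^sup>2))"

end

theory Submission
  imports Defs
begin

text \<open>For \<open>H = 1\<close> the optimisation over policies decouples into one problem per state:
  minimise \<open>max\<^sub>a c\<^sub>a / p\<^sub>a\<close> over distributions \<open>p\<close>. Summing \<open>c\<^sub>a \<le> t p\<^sub>a\<close>
  shows that every bound \<open>t\<close> is at least the sum of the \<open>c\<^sub>a\<close>, and \<open>p\<close> proportional to
  \<open>c\<close> attains it. The factor 10 comes from \<open>OPT(\<epsilon>)\<close>: its actions have effective gap
  at most \<open>3 \<epsilon>\<close>, so each contributes at most 9 times its own term of the sum.\<close>

section \<open>Optimal allocation of probability among weighted actions\<close>

lemma sum_le_SUP_div_pmf:
  fixes c :: "'a::finite \<Rightarrow> ennreal"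
  shows "(\<Sum>a\<in>A. c a) \<le> (SUP a\<in>A. c a / ennreal (pmf p a))" (is "_ \<le> ?t")
proof (cases "?t = top")
  case False
  have "c a \<le> ?t * ennreal (pmf p a)" if "a \<in> A" for a
  proof (cases "pmf p a = 0")
    case True
    \<comment> \<open>A positive \<open>c a\<close> divided by 0 would be infinite, so finiteness of
      \<open>?t\<close> forces \<open>c a = 0\<close>.\<close>
    have "c a / ennreal (pmf p a) \<le> ?t" using that by (intro SUP_upper)
    with True False have "c a = 0"
      by (auto simp: divide_ennreal_def ennreal_mult_top top_unique split: if_splits)
    then show ?thesis by simp
  next
    case pos: False
    have "c a = c a / ennreal (pmf p a) * ennreal (pmf p a)"
      using pos by (simp add: ennreal_divide_times ennreal_mult_divide_eq)
    also have "\<dots> \<le> ?t * ennreal (pmf p a)"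
      using that by (intro mult_right_mono SUP_upper) auto
    finally show ?thesis .
  qed
  then have "(\<Sum>a\<in>A. c a) \<le> (\<Sum>a\<in>A. ?t * ennreal (pmf p a))"
    by (intro sum_mono)
  also have "\<dots> = ?t * ennreal (\<Sum>a\<in>A. pmf p a)"
    by (simp add: sum_distrib_left[symmetric] sum_ennreal)
  also have "\<dots> \<le> ?t * 1"
  proof (intro mult_left_mono)
    have "(\<Sum>a\<in>A. pmf p a) = measure p A" by (simp add: measure_measure_pmf_finite)
    also have "\<dots> \<le> 1" by simp
    finally show "ennreal (\<Sum>a\<in>A. pmf p a) \<le> 1" by simp
  qed simp
  finally show ?thesis by simp
next
  case True
  show ?thesis by (simp only: True top_greatest)
qed

lemma obtain_proportional_pmf:
  fixes c :: "'a::finite \<Rightarrow> ennreal"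
  obtains p where "(SUP a\<in>A. c a / ennreal (pmf p a)) \<le> (\<Sum>a\<in>A. c a)"
proof -
  let ?S = "\<Sum>a\<in>A. c a"
  consider "?S = top" | "?S = 0" | "?S \<noteq> top" "?S \<noteq> 0" by blast
  then show thesis
  proof cases
    \<comment> \<open>When the sum is infinite, or all weights on \<open>A\<close> vanish, any
      distribution will do; the point mass is arbitrary.\<close>
    case 1 show ?thesis by (rule that[of "return_pmf undefined"]) (simp only: 1 top_greatest)
  next
    case 2
    show ?thesis
      by (rule that[of "return_pmf undefined"], rule SUP_least) (use 2 in auto)
  next
    case 3
    \<comment> \<open>Normalised weights, extended by 0 outside \<open>A\<close> so that the total
      mass over all actions is 1.\<close>
    define w where "w a = (if a \<in> A then enn2real (c a / ?S) else 0)" for a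
    have fin: "c a \<noteq> top" if "a \<in> A" for a using 3 that by auto
    have w: "ennreal (w a) = c a / ?S" if "a \<in> A" for a
      using 3 fin[OF that] that
      by (simp add: w_def ennreal_enn2real_if ennreal_divide_eq_top_iff del: sum_eq_0_iff)
    have "(\<integral>\<^sup>+a. ennreal (w a) \<partial>count_space UNIV) = (\<Sum>a\<in>UNIV. ennreal (w a))"
      by (simp add: nn_integral_count_space_finite)
    also have "\<dots> = (\<Sum>a\<in>A. ennreal (w a))"
      by (intro sum.mono_neutral_right) (auto simp: w_def)
    also have "\<dots> = (\<Sum>a\<in>A. c a / ?S)" by (simp add: w)
    also have "\<dots> = ?S / ?S" by (simp add: divide_ennreal_def sum_distrib_right)
    also have "\<dots> = 1" using 3 by (simp add: ennreal_divide_self less_top)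
    finally have p: "pmf (embed_pmf w) a = w a" for a
      by (intro pmf_embed_pmf) (auto simp: w_def)
    \<comment> \<open>A positive weight gives a ratio of exactly \<open>?S\<close>; a zero weight
      gives 0 / 0 = 0 in \<open>ennreal\<close>.\<close>
    have "c a / (c a / ?S) \<le> ?S" if "a \<in> A" for a
    proof (cases "c a = 0")
      case False
      have "c a = ?S * (c a / ?S)"
        using 3 by (metis ennreal_mult_divide_eq ennreal_times_divide mult.commute)
      then have "c a / (c a / ?S) = ?S * (c a / ?S) / (c a / ?S)" by simp
      also have "\<dots> = ?S"
        using 3 False fin[OF that]
        by (intro ennreal_mult_divide_eq) (simp_all add: ennreal_divide_eq_top_iff del: sum_eq_0_iff)
      finally show ?thesis by simp
    qed simp
    then show ?thesis by (intro that[of "embed_pmf w"]) (auto simp: SUP_le_iff p w)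
  qed
qed

text \<open>A policy chooses its action distribution at each state independently, so the statewise
  optimal distributions combine into a single policy. The sets \<open>A s\<close> may differ between
  states, as the sets of suboptimal actions do.\<close>

lemma INF_policy_SUP_div:
  fixes c :: "'s::finite \<Rightarrow> 'a::finite \<Rightarrow> ennreal"
  shows "(INF \<pi>::('s, 'a) policy. SUP (s, a)\<in>Sigma UNIV A. c s a / ennreal (pmf (\<pi> h s) a))
    = (SUP s. \<Sum>a\<in>A s. c s a)"
proof (rule antisym)
  have "\<forall>s. \<exists>p. (SUP a\<in>A s. c s a / ennreal (pmf p a)) \<le> (\<Sum>a\<in>A s. c s a)"
    using obtain_proportional_pmf by metis
  then obtain p where p: "(SUP a\<in>A s. c s a / ennreal (pmf (p s) a)) \<le> (\<Sum>a\<in>A s. c s a)" for s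
    by metis
  have "(SUP (s, a)\<in>Sigma UNIV A. c s a / ennreal (pmf (p s) a)) \<le> (SUP s. \<Sum>a\<in>A s. c s a)"
    using p by (auto simp: SUP_le_iff intro: SUP_upper2)
  then show "(INF \<pi>::('s, 'a) policy. SUP (s, a)\<in>Sigma UNIV A. c s a / ennreal (pmf (\<pi> h s) a))
      \<le> (SUP s. \<Sum>a\<in>A s. c s a)"
    by (intro INF_lower2[of "\<lambda>_. p"]) auto
next
  show "(SUP s. \<Sum>a\<in>A s. c s a)
    \<le> (INF \<pi>::('s, 'a) policy. SUP (s, a)\<in>Sigma UNIV A. c s a / ennreal (pmf (\<pi> h s) a))"
  proof (intro SUP_least INF_greatest)
    fix s and \<pi> :: "('s, 'a) policy"
    have "(\<Sum>a\<in>A s. c s a) \<le> (SUP a\<in>A s. c s a / ennreal (pmf (\<pi> h s) a))"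
      by (rule sum_le_SUP_div_pmf)
    also have "\<dots> \<le> (SUP (s, a)\<in>Sigma UNIV A. c s a / ennreal (pmf (\<pi> h s) a))"
      by (intro SUP_least SUP_upper2[of "(s, _)"]) auto
    finally show "(\<Sum>a\<in>A s. c s a)
      \<le> (SUP (s, a)\<in>Sigma UNIV A. c s a / ennreal (pmf (\<pi> h s) a))" .
  qed
qed

section \<open>Reachability, visitation and gaps when H = 1\<close>

lemma state_law_1: "state_law M \<pi> 1 = init_dist M"
  by (simp add: state_law_def)

lemma max_reach_1: "max_reach M 1 s = pmf (init_dist M) s"
  by (simp add: max_reach_def state_law_1 del: One_nat_def)

lemma init_dist_single_state:
  assumes "(UNIV :: 's set) = {s}"
  shows "pmf (init_dist (M :: ('s, 'a) mdp)) s' = 1"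
proof -
  have "pmf (init_dist M) s = measure (init_dist M) (UNIV :: 's set)"
    by (simp add: assms measure_pmf_single)
  moreover have "s' = s" using assms by (metis UNIV_I singletonD)
  ultimately show ?thesis by simp
qed

lemma max_reach_single_state:
  assumes "(UNIV :: 's set) = {s}"
  shows "max_reach (M :: ('s, 'a) mdp) 1 s' = 1"
  by (simp add: max_reach_1 init_dist_single_state[OF assms] del: One_nat_def)

lemma visitation_1:
  fixes M :: "('s::finite, 'a::finite) mdp"
  shows "visitation M \<pi> 1 s a = pmf (init_dist M) s * pmf (\<pi> 1 s) a"
proof -
  have "pmf (map_pmf (Pair s') p) (s, a) = (if s' = s then pmf p a else 0)" for s' and p :: "'a pmf"
    by (auto simp: pmf_map_inj' inj_on_def pmf_eq_0_set_pmf)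
  moreover have "visitation M \<pi> 1 s a
      = (\<Sum>s'\<in>UNIV. pmf (map_pmf (Pair s') (\<pi> 1 s')) (s, a) * pmf (init_dist M) s')"
    unfolding visitation_def state_action_law_def state_law_1 pmf_bind
    by (rule integral_measure_pmf_real) auto
  ultimately show ?thesis
    by (simp add: if_distrib[of "\<lambda>x. _ * x"] mult.commute cong: if_cong del: One_nat_def)
qed

text \<open>The point mass at \<open>a\<close> competes in the supremum that defines the optimal
  value. The consequence used later is that an action without positive gap is optimal.\<close>

lemma gap_nonneg:
  fixes M :: "('s::finite, 'a::finite) mdp"
  assumes "horizon M = 1"
  shows "0 \<le> gap M 1 s a"
proof -
  let ?r = "mean_reward M 1 s"
  have v: "value_fun M \<pi> 1 s = measure_pmf.expectation (\<pi> 1 s) ?r" for \<pi>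
    using assms by (simp add: value_fun_def)
  have q: "opt_action_value M 1 s a = ?r a"
  proof -
    \<comment> \<open>Step 2 lies beyond the horizon, so this value is an empty sum.\<close>
    have "value_fun M \<pi> (1 + 1) = (\<lambda>_. 0)" for \<pi>
      using assms by (auto simp: value_fun_def)
    then show ?thesis
      unfolding opt_action_value_def action_value_def by simp
  qed
  \<comment> \<open>A real \<open>SUP\<close> is known to dominate its members only once the set is
    bounded above.\<close>
  have "measure_pmf.expectation (\<pi> 1 s) ?r \<le> Max (range ?r)" for \<pi> :: "('s, 'a) policy"
    by (intro measure_pmf.integral_le_const integrable_measure_pmf_finite) auto
  then have bdd: "bdd_above (range (\<lambda>\<pi>. value_fun M \<pi> 1 s))"
    by (intro bdd_aboveI) (auto simp: v simp del: One_nat_def)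
  have "?r a = value_fun M (\<lambda>_ _. return_pmf a) 1 s" by (subst v) simp
  also have "\<dots> \<le> opt_value M 1 s"
    unfolding opt_value_def by (rule cSUP_upper[OF UNIV_I bdd])
  finally show ?thesis by (simp add: gap_def q del: One_nat_def)
qed

text \<open>Only an infimum over an empty set of positive gaps can be infinite. Then every gap is 0,
  every action is optimal, and uniqueness leaves one action.\<close>

lemma eff_gap_eq_top_imp_single_action:
  fixes M :: "('s::finite, 'a::finite) mdp"
  assumes "horizon M = 1" and "eff_gap M 1 s a = top"
  shows "(UNIV :: 'a set) = {a}"
proof -
  have uniq: "\<exists>!a. optimal_action M 1 s a"
    and inf: "(INF a'\<in>{a'. gap M 1 s a' > 0}. ennreal (gap M 1 s a')) = top"
    using assms(2) by (auto simp: eff_gap_def split: if_splits simp del: One_nat_def)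
  have "\<not> gap M 1 s a' > 0" for a'
  proof
    assume "gap M 1 s a' > 0"
    then have "top \<le> ennreal (gap M 1 s a')" unfolding inf[symmetric] by (intro INF_lower) simp
    then show False by (simp add: top_unique)
  qed
  then have "optimal_action M 1 s a'" for a'
    using gap_nonneg[OF assms(1), of s a']
    by (simp add: optimal_action_def order_antisym not_less del: One_nat_def)
  then show ?thesis using uniq by auto
qed

section \<open>The two complexities of one-step MDPs\<close>

lemma complexity_star_contextual_bandit:
  fixes M :: "('s::finite, 'a::finite) mdp"
  assumes "horizon M = 1"
  shows "complexity_star M =
    (SUP s. 1 / ennreal (max_reach M 1 s) *
       (\<Sum>a | gap M 1 s a > 0. 1 / (ennreal (gap M 1 s a))\<^sup>2))"
proof -
  \<comment> \<open>The inverse of the product splits because all factors are finite. Zero factors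
    do no harm: if \<open>W(s) = 0\<close>, both sides are infinite.\<close>
  have "1 / (ennreal (visitation M \<pi> 1 s a) * (ennreal g)\<^sup>2)
      = 1 / ennreal (max_reach M 1 s) * (1 / (ennreal g)\<^sup>2) / ennreal (pmf (\<pi> 1 s) a)"
    for \<pi> s a g
    by (simp add: visitation_1 max_reach_1 divide_ennreal_def ennreal_mult ennreal_inverse_mult
        ennreal_mult_less_top power_less_top_ennreal mult_ac del: One_nat_def)
  moreover have "{(s, a). gap M 1 s a > 0} = Sigma UNIV (\<lambda>s. {a. gap M 1 s a > 0})" by auto
  ultimately show ?thesis
    using assms
      INF_policy_SUP_div[where
        c = "\<lambda>s a. 1 / ennreal (max_reach M 1 s) * (1 / (ennreal (gap M 1 s a))\<^sup>2)" and
        A = "\<lambda>s. {a. gap M 1 s a > 0}" and h = 1]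
    by (simp add: complexity_star_def sum_distrib_left del: One_nat_def)
qed

text \<open>Since \<open>W = 1\<close>, both arguments of the minimum have the factor
  \<open>1 / w\<close>. Pulling it out leaves weights independent of the policy, to which the
  allocation result applies.\<close>

lemma complexity_bandit:
  fixes M :: "('s::finite, 'a::finite) mdp"
  assumes "horizon M = 1" and s: "(UNIV :: 's set) = {s}"
  shows "complexity M \<epsilon> =
    (\<Sum>a\<in>UNIV. min (1 / (eff_gap M 1 s a)\<^sup>2) (1 / (ennreal \<epsilon>)\<^sup>2))
      + of_nat (card (OPT M \<epsilon>)) / (ennreal \<epsilon>)\<^sup>2"
proof -
  let ?c = "\<lambda>s a. min (1 / (eff_gap M 1 s a)\<^sup>2) (1 / (ennreal \<epsilon>)\<^sup>2)"
  have "min (1 / (ennreal (pmf p a) * (eff_gap M 1 s' a)\<^sup>2)) (1 / (ennreal (pmf p a) * (ennreal \<epsilon>)\<^sup>2))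
      = ?c s' a / ennreal (pmf p a)" for s' a and p :: "'a pmf"
  proof -
    let ?w = "ennreal (pmf p a)"
    have "1 / (?w * (eff_gap M 1 s' a)\<^sup>2) = 1 / (eff_gap M 1 s' a)\<^sup>2 / ?w"
    proof (cases "eff_gap M 1 s' a = top")
      case True
      \<comment> \<open>The equation fails for \<open>p a = 0\<close>, where it reads \<open>\<infinity> = 0\<close>; the single action excludes this.\<close>
      then have "measure p {a} = measure p (UNIV :: 'a set)"
        using eff_gap_eq_top_imp_single_action[OF assms(1)] by metis
      then have "pmf p a = 1" by (simp add: measure_pmf_single)
      then show ?thesis by (simp add: divide_ennreal_def)
    next
      case False
      then show ?thesis
        by (simp add: divide_ennreal_def ennreal_inverse_mult power_less_top_ennreal less_top
            mult.commute)
    qed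
    moreover have "1 / (?w * (ennreal \<epsilon>)\<^sup>2) = 1 / (ennreal \<epsilon>)\<^sup>2 / ?w"
      by (simp add: divide_ennreal_def ennreal_inverse_mult power_less_top_ennreal mult.commute)
    \<comment> \<open>Monotonicity lets division by \<open>?w\<close> commute with
      \<open>min\<close>.\<close>
    moreover have "mono (\<lambda>x::ennreal. x / ?w)"
      by (intro monoI divide_right_mono_ennreal)
    ultimately show ?thesis by (simp add: min_of_mono[where f = "\<lambda>x. x / ?w"] del: One_nat_def)
  qed
  moreover have "(SUP s'. \<Sum>a\<in>UNIV. ?c s' a) = (\<Sum>a\<in>UNIV. ?c s a)" by (simp add: s)
  ultimately show ?thesis
    using INF_policy_SUP_div[where c = ?c and A = "\<lambda>_. UNIV" and h = 1] assms(1)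
    by (simp add: complexity_def visitation_1 max_reach_1 init_dist_single_state[OF s] del: One_nat_def)
qed

lemma card_OPT_bandit_le:
  fixes M :: "('s::finite, 'a::finite) mdp"
  assumes "horizon M = 1" and s: "(UNIV :: 's set) = {s}" and "\<epsilon> > 0"
  shows "of_nat (card (OPT M \<epsilon>)) / (ennreal \<epsilon>)\<^sup>2
    \<le> 9 * (\<Sum>a\<in>UNIV. min (1 / (eff_gap M 1 s a)\<^sup>2) (1 / (ennreal \<epsilon>)\<^sup>2))"
proof -
  let ?c = "\<lambda>a. min (1 / (eff_gap M 1 s a)\<^sup>2) (1 / (ennreal \<epsilon>)\<^sup>2)"
  define A where "A = {a. eff_gap M 1 s a / 3 \<le> ennreal \<epsilon>}"
  have "OPT M \<epsilon> = (\<lambda>a. (s, a, 1)) ` A"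
  proof -
    have "s' = s" for s' using s by (metis UNIV_I singletonD)
    then show ?thesis
      using assms(1) max_reach_single_state[OF s, of M]
      by (fastforce simp: OPT_def A_def image_iff simp del: One_nat_def)
  qed
  then have card: "card (OPT M \<epsilon>) = card A"
    by (simp add: card_image inj_on_def)
  have "1 / (ennreal \<epsilon>)\<^sup>2 \<le> 9 * ?c a" if aA: "a \<in> A" for a
  proof -
    \<comment> \<open>An infinite effective gap stays infinite after division by 3, so it cannot
      occur in \<open>A\<close>.\<close>
    obtain g where g: "0 \<le> g" "eff_gap M 1 s a = ennreal g"
    proof (cases "eff_gap M 1 s a")
      case top
      then show ?thesis
        using aA by (simp add: A_def ennreal_top_divide top_unique del: One_nat_def)
    qed
    have le: "g \<le> 3 * \<epsilon>"
      using aA g assms(3) by (simp add: A_def ennreal_divide_numeral)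
    have "1 / (ennreal \<epsilon>)\<^sup>2 \<le> 9 * (1 / (ennreal g)\<^sup>2)"
    \<comment> \<open>For \<open>g = 0\<close> the right-hand side is infinite; otherwise the bound
      \<open>g \<le> 3 * \<epsilon>\<close> is squared.\<close>
    proof (cases "g = 0")
      case True
      then show ?thesis by (simp add: ennreal_mult_top)
    next
      case False
      have "g\<^sup>2 \<le> (3 * \<epsilon>)\<^sup>2" using le g(1) by (intro power_mono)
      then have "1 / \<epsilon>\<^sup>2 \<le> 9 * (1 / g\<^sup>2)"
        using False g(1) assms(3) by (simp add: field_simps power2_eq_square)
      then have "ennreal (1 / \<epsilon>\<^sup>2) \<le> ennreal (9 * (1 / g\<^sup>2))" by (rule ennreal_leI)
      also have "ennreal (9 * (1 / g\<^sup>2)) = ennreal 9 * ennreal (1 / g\<^sup>2)"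
        by (rule ennreal_mult) auto
      finally show ?thesis
        using False g(1) assms(3) by (simp add: ennreal_power divide_ennreal flip: ennreal_1)
    qed
    moreover have "1 / (ennreal \<epsilon>)\<^sup>2 \<le> 9 * (1 / (ennreal \<epsilon>)\<^sup>2)"
      using mult_right_mono[of 1 9 "1 / (ennreal \<epsilon>)\<^sup>2"] by simp
    ultimately show ?thesis by (auto simp: min_def g simp del: One_nat_def)
  qed
  then have "(\<Sum>a\<in>A. 1 / (ennreal \<epsilon>)\<^sup>2) \<le> (\<Sum>a\<in>A. 9 * ?c a)" by (rule sum_mono)
  also have "\<dots> \<le> (\<Sum>a\<in>UNIV. 9 * ?c a)" by (intro sum_mono2) auto
  finally show ?thesis
    by (simp add: card sum_distrib_left ennreal_times_divide del: One_nat_def)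
qed

text \<open>The additive \<open>OPT\<close> term in \<open>complexity\<close> breaks exact equality
  with the sum whenever \<open>OPT\<close> is nonempty; agreement up to a constant factor remains.
  The bandit formula for \<open>complexity_star\<close> is the contextual one with
  \<open>W = 1\<close>.\<close>

theorem proposition5:
  fixes M :: "('s::finite, 'a::finite) mdp"
  assumes "is_mdp M" and "horizon M = 1"
  shows
    "(CARD('s) = 1 \<longrightarrow>
       (\<forall>s::'s.
         (\<forall>\<epsilon>::real. \<epsilon> > 0 \<longrightarrow>
           (let S = (\<Sum>a\<in>UNIV. min (1 / (eff_gap M 1 s a)\<^sup>2) (1 / (ennreal \<epsilon>)\<^sup>2))
            in complexity M \<epsilon> = S + of_nat (card (OPT M \<epsilon>)) / (ennreal \<epsilon>)\<^sup>2 \<and>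
               S \<le> complexity M \<epsilon> \<and> complexity M \<epsilon> \<le> 10 * S \<and>
               (complexity M \<epsilon> = S \<longleftrightarrow> OPT M \<epsilon> = {}))) \<and>
         (unique_optimal_actions M \<longrightarrow>
           complexity_star M = (\<Sum>a | gap M 1 s a > 0. 1 / (ennreal (gap M 1 s a))\<^sup>2)))) \<and>
     (unique_optimal_actions M \<longrightarrow>
       complexity_star M =
         (SUP s. 1 / ennreal (max_reach M 1 s) *
            (\<Sum>a | gap M 1 s a > 0. 1 / (ennreal (gap M 1 s a))\<^sup>2)))"
proof (intro conjI impI allI)
  show "complexity_star M = (SUP s. 1 / ennreal (max_reach M 1 s) *
    (\<Sum>a | gap M 1 s a > 0. 1 / (ennreal (gap M 1 s a))\<^sup>2))"
    by (rule complexity_star_contextual_bandit) fact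
next
  fix s :: 's
  assume "CARD('s) = 1"
  then have s: "(UNIV :: 's set) = {s}" by (metis UNIV_I card_1_singletonE singletonD)
  show "complexity_star M = (\<Sum>a | gap M 1 s a > 0. 1 / (ennreal (gap M 1 s a))\<^sup>2)"
    using complexity_star_contextual_bandit[OF assms(2)]
    by (simp add: s max_reach_single_state[OF s] del: One_nat_def)
  fix \<epsilon> :: real
  assume \<epsilon>: "\<epsilon> > 0"
  define S where "S = (\<Sum>a\<in>UNIV. min (1 / (eff_gap M 1 s a)\<^sup>2) (1 / (ennreal \<epsilon>)\<^sup>2))"
  define K where "K = of_nat (card (OPT M \<epsilon>)) / (ennreal \<epsilon>)\<^sup>2"
  have C: "complexity M \<epsilon> = S + K"
    unfolding S_def K_def by (rule complexity_bandit[OF assms(2) s])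
  have K: "K \<le> 9 * S"
    unfolding S_def K_def by (rule card_OPT_bandit_le[OF assms(2) s \<epsilon>])
  have "S + K \<le> S + 9 * S" using K by (rule add_left_mono)
  also have "\<dots> = 10 * S" using distrib_right[of 1 9 S] by simp
  finally have upper: "S + K \<le> 10 * S" .
  \<comment> \<open>Cancelling \<open>S\<close> in \<open>S + K = S\<close> requires
    \<open>S\<close> to be finite. Finiteness of \<open>OPT\<close> then matters because
    \<open>card\<close> is 0 on infinite sets too.\<close>
  have "1 / (ennreal \<epsilon>)\<^sup>2 < top"
    using \<epsilon> by (simp add: less_top[symmetric] ennreal_divide_eq_top_iff)
  then have "S < top" unfolding S_def by (auto intro: min.strict_coboundedI2)
  moreover have "finite (OPT M \<epsilon>)"
    by (rule finite_subset[of _ "UNIV \<times> UNIV \<times> {1..horizon M}"]) (auto simp: OPT_def)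
  ultimately have iff: "S + K = S \<longleftrightarrow> OPT M \<epsilon> = {}"
    using \<epsilon> ennreal_add_left_cancel[of S K 0] by (auto simp: K_def power_eq_top_ennreal)
  show "let S = (\<Sum>a\<in>UNIV. min (1 / (eff_gap M 1 s a)\<^sup>2) (1 / (ennreal \<epsilon>)\<^sup>2))
    in complexity M \<epsilon> = S + of_nat (card (OPT M \<epsilon>)) / (ennreal \<epsilon>)\<^sup>2 \<and>
       S \<le> complexity M \<epsilon> \<and> complexity M \<epsilon> \<le> 10 * S \<and>
       (complexity M \<epsilon> = S \<longleftrightarrow> OPT M \<epsilon> = {})"
    unfolding Let_def S_def[symmetric] K_def[symmetric] C using upper iff by simp
qed

end
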